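(* There is a function $\varepsilon(n)$ with $\varepsilon(n)\to 0$ as $n\to\infty$ such that the following holds. For every $n\ge 1$ and every 2-colouring of the edges of the $n$-dimensional hypercube $Q_n$, there is a vertex $v\in V(Q_n)$ and a geodesic path in $Q_n$ from $v$ to its antipode $\bar v$ which changes colour at most $(\tfrac{\pi}{2}+\varepsilon(n))\sqrt{n}$ times.
   Context: $Q_n$ is the graph on $\{0,1\}^n$ in which two vertices are adjacent iff they differ in exactly one coordinate. The antipode $\bar v$ of $v$ is the vertex differing from $v$ in every coordinate. A geodesic path is a shortest path in $Q_n$ (so a geodesic from $v$ to $\bar v$ has length $n$). The number of colour changes of a path with edges $e_1,\dots,e_m$ in order is the number of indices $i$ with $e_i$ and $e_{i+1}$ of different colours. *)

theory Defs
  imports Complex_Main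
begin

definition cube_verts :: "nat \<Rightarrow> bool list set" where
  "cube_verts n = {v. length v = n}"

definition cube_adj :: "nat \<Rightarrow> bool list \<Rightarrow> bool list \<Rightarrow> bool" where
  "cube_adj n u v \<longleftrightarrow> u \<in> cube_verts n \<and> v \<in> cube_verts n \<and> card {i. i < n \<and> u ! i \<noteq> v ! i} = 1"

definition antipode :: "bool list \<Rightarrow> bool list" where
  "antipode v = map Not v"

text \<open>A path is given by its nonempty list of pairwise distinct vertices; its number of edges is
  one less than the length of that list.\<close>

definition cube_path :: "nat \<Rightarrow> bool list \<Rightarrow> bool list \<Rightarrow> bool list list \<Rightarrow> bool" where
  "cube_path n u v p \<longleftrightarrow> p \<noteq> [] \<and> hd p = u \<and> last p = v \<and> set p \<subseteq> cube_verts n \<and> distinct p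
     \<and> successively (cube_adj n) p"

definition cube_geodesic :: "nat \<Rightarrow> bool list \<Rightarrow> bool list \<Rightarrow> bool list list \<Rightarrow> bool" where
  "cube_geodesic n u v p \<longleftrightarrow> cube_path n u v p \<and> (\<forall>q. cube_path n u v q \<longrightarrow> length p \<le> length q)"

text \<open>Edges are unordered pairs \<open>{x, y}\<close> of adjacent vertices, listed in the order of traversal.\<close>

definition path_edges :: "'v list \<Rightarrow> 'v set list" where
  "path_edges p = map2 (\<lambda>x y. {x, y}) p (tl p)"

definition colour_changes :: "('v set \<Rightarrow> 'c) \<Rightarrow> 'v list \<Rightarrow> nat" where
  "colour_changes c p = card {i. Suc i < length (path_edges p)
     \<and> c (path_edges p ! i) \<noteq> c (path_edges p ! Suc i)}"

end

theory Submission
  imports Defs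
begin

text \<open>For a vertex \<open>w\<close>, a set \<open>S\<close> of \<open>k\<close> directions and \<open>i \<in> S\<close>, consider geodesics from \<open>w\<close> that use
  exactly the directions in \<open>S\<close> and start with \<open>i\<close>. Such a geodesic can be extended at \<open>w\<close> by any
  direction outside \<open>S\<close>. If \<open>p\<close> and \<open>q\<close> are the proportions of red edges at \<open>w\<close> among the directions
  inside and outside \<open>S\<close>, then the uniform distributions on \<open>S\<close> and on its complement can be coupled
  so that the colours differ with probability only \<open>\<bar>p - q\<bar>\<close>. Since \<open>S\<close> is a uniformly random
  \<open>k\<close>-subset, the hypergeometric variance bounds the mean of \<open>\<bar>p - q\<bar>\<close> by
  \<open>n / (2 sqrt (n - 1) sqrt (k (n - k)))\<close>. Summing over \<open>k\<close> and comparing with the integral of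
  \<open>1 / sqrt (x (n - x))\<close> over \<open>[0, n]\<close>, which is \<open>\<pi>\<close>, the average of the minimal number of colour changes
  over all \<open>w\<close> and all first directions is at most \<open>\<pi>/2 \<cdot> n / sqrt (n - 1)\<close>.\<close>

section \<open>Walks in the cube given by lists of directions\<close>

definition flip :: "bool list \<Rightarrow> nat \<Rightarrow> bool list" where
  "flip w i = w[i := \<not> w ! i]"

text \<open>A path is encoded by its start and its directions, so that a geodesic from a vertex to
  its antipode is an ordering of all \<open>n\<close> directions.\<close>

primrec flip_path :: "bool list \<Rightarrow> nat list \<Rightarrow> bool list list" where
  "flip_path w [] = [w]"
| "flip_path w (i # ds) = w # flip_path (flip w i) ds"

lemma length_flip [simp]: "length (flip w i) = length w"
  by (simp add: flip_def)

lemma nth_flip: "j < length w \<Longrightarrow> flip w i ! j = (if i = j then \<not> w ! j else w ! j)"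
  by (auto simp: flip_def nth_list_update)

lemma flip_flip: "flip (flip w i) i = w"
  by (cases "i < length w") (auto simp: flip_def list_update_beyond)

lemma flip_in_cube_verts [simp]: "flip w i \<in> cube_verts n \<longleftrightarrow> w \<in> cube_verts n"
  by (simp add: cube_verts_def)

lemma cube_adj_flip:
  assumes "w \<in> cube_verts n" "i < n"
  shows "cube_adj n w (flip w i)"
proof -
  have "{j. j < n \<and> w ! j \<noteq> flip w i ! j} = {i}"
    using assms by (auto simp: cube_verts_def nth_flip split: if_splits)
  then show ?thesis
    using assms by (simp add: cube_adj_def)
qed

lemma finite_cube_verts: "finite (cube_verts n)"
  using finite_lists_length_eq[of "UNIV :: bool set" n] by (simp add: cube_verts_def)

lemma card_cube_verts: "card (cube_verts n) = 2 ^ n"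
  using card_lists_length_eq[of "UNIV :: bool set" n] by (simp add: cube_verts_def)

text \<open>Flipping is an involution on the vertices. This moves the base point from
  \<open>w\<close> to its neighbour when averages are compared.\<close>

lemma sum_cube_verts_flip: "(\<Sum>w\<in>cube_verts n. f (flip w i)) = (\<Sum>w\<in>cube_verts n. f w)"
  by (rule sum.reindex_bij_witness[where i = "\<lambda>w. flip w i" and j = "\<lambda>w. flip w i"])
    (auto simp: flip_flip)

lemma flip_path_neq_Nil [simp]: "flip_path w ds \<noteq> []"
  by (cases ds) auto

lemma hd_flip_path [simp]: "hd (flip_path w ds) = w"
  by (cases ds) auto

lemma length_flip_path [simp]: "length (flip_path w ds) = Suc (length ds)"
  by (induction ds arbitrary: w) auto

lemma flip_path_nth_unused:
  "u \<in> set (flip_path w ds) \<Longrightarrow> i \<notin> set ds \<Longrightarrow> i < length w \<Longrightarrow> u ! i = w ! i"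
proof (induction ds arbitrary: w)
  case (Cons a ds)
  then have "u = w \<or> u ! i = flip w a ! i"
    by auto
  then show ?case
    using Cons.prems by (auto simp: nth_flip)
qed simp

lemma length_in_flip_path: "u \<in> set (flip_path w ds) \<Longrightarrow> length u = length w"
  by (induction ds arbitrary: w) auto

lemma distinct_flip_path:
  "distinct ds \<Longrightarrow> set ds \<subseteq> {..<length w} \<Longrightarrow> distinct (flip_path w ds)"
proof (induction ds arbitrary: w)
  case (Cons i ds)
  have "w \<notin> set (flip_path (flip w i) ds)"
  proof
    assume "w \<in> set (flip_path (flip w i) ds)"
    then have "w ! i = flip w i ! i"
      using Cons.prems by (intro flip_path_nth_unused) auto
    then show False
      using Cons.prems by (simp add: nth_flip)
  qed
  then show ?case
    using Cons by simp
qed simp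

lemma successively_flip_path:
  "w \<in> cube_verts n \<Longrightarrow> set ds \<subseteq> {..<n} \<Longrightarrow> successively (cube_adj n) (flip_path w ds)"
  by (induction ds arbitrary: w) (auto simp: successively_Cons cube_adj_flip)

lemma nth_last_flip_path:
  "distinct ds \<Longrightarrow> i < length w \<Longrightarrow>
    last (flip_path w ds) ! i = (if i \<in> set ds then \<not> w ! i else w ! i)"
  by (induction ds arbitrary: w) (auto simp: nth_flip)

lemma last_flip_path_antipode:
  assumes "distinct ds" "set ds = {..<length w}"
  shows "last (flip_path w ds) = antipode w"
proof (rule nth_equalityI)
  show "length (last (flip_path w ds)) = length (antipode w)"
    using length_in_flip_path[of "last (flip_path w ds)" w ds] by (simp add: antipode_def)
  then show "last (flip_path w ds) ! i = antipode w ! i" if "i < length (last (flip_path w ds))" for i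
    using that assms by (simp add: antipode_def nth_last_flip_path)
qed

text \<open>Every step changes one coordinate, so the triangle inequality for the Hamming distance
  applies. This lower bound shows that a path to the antipode with \<open>n\<close> edges is
  shortest.\<close>

lemma hamming_dist_less_length:
  "successively (cube_adj n) p \<Longrightarrow> p \<noteq> [] \<Longrightarrow> card {i. i < n \<and> hd p ! i \<noteq> last p ! i} < length p"
proof (induction p)
  case (Cons u p)
  show ?case
  proof (cases "p = []")
    case False
    then have adj: "cube_adj n u (hd p)" and IH: "card {i. i < n \<and> hd p ! i \<noteq> last p ! i} < length p"
      using Cons by (auto simp: successively_Cons)
    have "{i. i < n \<and> u ! i \<noteq> last p ! i}
        \<subseteq> {i. i < n \<and> u ! i \<noteq> hd p ! i} \<union> {i. i < n \<and> hd p ! i \<noteq> last p ! i}"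
      by auto
    then have "card {i. i < n \<and> u ! i \<noteq> last p ! i}
        \<le> card ({i. i < n \<and> u ! i \<noteq> hd p ! i} \<union> {i. i < n \<and> hd p ! i \<noteq> last p ! i})"
      by (intro card_mono) auto
    also have "\<dots> \<le> 1 + card {i. i < n \<and> hd p ! i \<noteq> last p ! i}"
      using adj card_Un_le[of "{i. i < n \<and> u ! i \<noteq> hd p ! i}" "{i. i < n \<and> hd p ! i \<noteq> last p ! i}"]
      by (simp add: cube_adj_def)
    finally show ?thesis
      using IH False by simp
  qed simp
qed simp

lemma cube_geodesic_flip_path:
  assumes w: "w \<in> cube_verts n" and ds: "distinct ds" "set ds = {..<n}"
  shows "cube_geodesic n w (antipode w) (flip_path w ds)"
proof -
  have len: "length w = n"
    using w by (simp add: cube_verts_def)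
  have "set (flip_path w ds) \<subseteq> cube_verts n"
    using length_in_flip_path len by (auto simp: cube_verts_def)
  then have "cube_path n w (antipode w) (flip_path w ds)"
    using assms len
    by (simp add: cube_path_def last_flip_path_antipode distinct_flip_path successively_flip_path)
  moreover have "length (flip_path w ds) \<le> length q" if "cube_path n w (antipode w) q" for q
  proof -
    have "{i. i < n \<and> hd q ! i \<noteq> last q ! i} = {..<n}"
      using that len by (auto simp: cube_path_def antipode_def)
    then have "n < length q"
      using hamming_dist_less_length[of n q] that by (simp add: cube_path_def)
    moreover have "length ds = n"
      using ds distinct_card by fastforce
    ultimately show ?thesis by simp
  qed
  ultimately show ?thesis
    by (simp add: cube_geodesic_def)
qed

section \<open>Minimal numbers of colour changes with a prescribed first direction\<close>

lemma colour_changes_short: "length p \<le> 2 \<Longrightarrow> colour_changes c p = 0"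
proof -
  assume "length p \<le> 2"
  then have no_pair: "\<not> Suc i < length (path_edges p)" for i
    by (auto simp: path_edges_def)
  show ?thesis
    by (simp add: colour_changes_def no_pair)
qed

lemma colour_changes_Cons:
  "colour_changes c (x # y # z # p) = of_bool (c {x, y} \<noteq> c {y, z}) + colour_changes c (y # z # p)"
proof -
  define es where "es = path_edges (y # z # p)"
  have es: "path_edges (x # y # z # p) = {x, y} # es" "es ! 0 = {y, z}" "es \<noteq> []"
    by (simp_all add: es_def path_edges_def)
  have "{i. Suc i < length ({x, y} # es) \<and> c (({x, y} # es) ! i) \<noteq> c (({x, y} # es) ! Suc i)}
      = (if c {x, y} \<noteq> c {y, z} then {0} else {})
        \<union> Suc ` {i. Suc i < length es \<and> c (es ! i) \<noteq> c (es ! Suc i)}" (is "?L = ?A \<union> Suc ` ?B")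
  proof (intro set_eqI)
    fix i show "i \<in> ?L \<longleftrightarrow> i \<in> ?A \<union> Suc ` ?B"
      using es(2,3) by (cases i) (auto simp: image_iff)
  qed
  moreover have "card (?A \<union> Suc ` ?B) = card ?A + card (Suc ` ?B)"
    by (rule card_Un_disjoint) (auto intro: finite_subset[of _ "{..<length es}"])
  moreover have "card (Suc ` ?B) = card ?B"
    by (simp add: card_image)
  ultimately have "card ?L = of_bool (c {x, y} \<noteq> c {y, z}) + card ?B"
    by (simp split: if_splits)
  then show ?thesis
    unfolding colour_changes_def es(1) by (simp add: es_def)
qed

text \<open>The first direction is fixed because a path extended at its start \<open>w\<close> gains
  a change only through its first edge. For finite \<open>S\<close> some ordering exists, so the
  infimum is a minimum.\<close>

definition min_changes :: "(bool list set \<Rightarrow> 'c) \<Rightarrow> bool list \<Rightarrow> nat set \<Rightarrow> nat \<Rightarrow> nat" where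
  "min_changes c w S i =
     (INF ds\<in>{ds. distinct ds \<and> set ds = S - {i}}. colour_changes c (flip_path w (i # ds)))"

lemma min_changes_le:
  "distinct ds \<Longrightarrow> set ds = S - {i} \<Longrightarrow> min_changes c w S i \<le> colour_changes c (flip_path w (i # ds))"
  unfolding min_changes_def by (rule cINF_lower) auto

lemma min_changes_attained:
  assumes "finite S"
  obtains ds where "distinct ds" "set ds = S - {i}"
    "min_changes c w S i = colour_changes c (flip_path w (i # ds))"
proof -
  have "{ds. distinct ds \<and> set ds = S - {i}} \<noteq> {}"
    using finite_distinct_list[of "S - {i}"] assms by auto
  then have "min_changes c w S i
      \<in> (\<lambda>ds. colour_changes c (flip_path w (i # ds))) ` {ds. distinct ds \<and> set ds = S - {i}}"
    unfolding min_changes_def by (intro Inf_nat_def1) auto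
  then show thesis
    using that by auto
qed

lemma min_changes_singleton: "min_changes c w {i} i = 0"
  using min_changes_le[of "[]" "{i}" i c w] by (simp add: colour_changes_short)

text \<open>Prepend the edge from \<open>flip w j\<close> to \<open>w\<close> to an optimal path;
  the only new place for a colour change is the junction at \<open>w\<close>.\<close>

lemma min_changes_insert_le:
  assumes "finite S" "i \<in> S" "j \<notin> S"
  shows "min_changes c (flip w j) (insert j S) j
    \<le> min_changes c w S i + of_bool (c {w, flip w i} \<noteq> c {w, flip w j})"
proof -
  obtain ds where ds: "distinct ds" "set ds = S - {i}"
      and eq: "min_changes c w S i = colour_changes c (flip_path w (i # ds))"
    using min_changes_attained[OF assms(1)] by metis
  obtain p where p: "flip_path (flip w i) ds = flip w i # p"
    by (cases ds) auto
  have "min_changes c (flip w j) (insert j S) j \<le> colour_changes c (flip_path (flip w j) (j # i # ds))"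
    using ds assms by (intro min_changes_le) auto
  also have "\<dots> = min_changes c w S i + of_bool (c {w, flip w i} \<noteq> c {w, flip w j})"
    by (auto simp: eq flip_flip p colour_changes_Cons insert_commute)
  finally show ?thesis .
qed

section \<open>Coupling of two uniform distributions with two colours\<close>

text \<open>Here \<open>x\<close>, \<open>y\<close> count the red and blue elements of the first set and \<open>z\<close>, \<open>t\<close> those of the second;
  \<open>a1\<close>, \<open>a2\<close>, \<open>b1\<close>, \<open>b2\<close> are the corresponding sums. Red has the larger share in the first set, so the
  optimal coupling moves the excess from red to blue only. Denominators are cleared because either
  colour class may be empty.\<close>

lemma coupling_ineq_wlog:
  fixes x y z t a1 a2 b1 b2 :: real
  assumes nn: "x \<ge> 0" "y \<ge> 0" "z \<ge> 0" "t \<ge> 0"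
    and b11: "x * b1 \<le> z * a1" and b22: "y * b2 \<le> t * a2" and b12: "x * b2 \<le> t * (a1 + x)"
    and z: "z = 0 \<Longrightarrow> b1 = 0" and t: "t = 0 \<Longrightarrow> b2 = 0"
    and y: "y = 0 \<Longrightarrow> a2 = 0" and x: "x = 0 \<Longrightarrow> a1 = 0"
    and le: "z * y \<le> x * t"
  shows "(x + y) * (b1 + b2) \<le> (z + t) * (a1 + a2) + (x * t - z * y)"
proof (cases "x = 0 \<or> t = 0")
  case True
  \<comment> \<open>There is no excess here; the implications for empty classes settle the
    degenerate cases.\<close>
  then have "z * y = 0" using le nn by (auto simp: mult_le_0_iff intro: antisym)
  then show ?thesis
    using True assms by (auto simp: algebra_simps)
next
  case False
  then have "x > 0" "t > 0" using nn by auto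
  let ?d = "x * t - z * y"
  have 1: "(x + y) * b1 \<le> (x + y) / x * (z * a1)"
    using mult_left_mono[OF b11, of "(x + y) / x"] \<open>x > 0\<close> nn by simp
  \<comment> \<open>The total weight \<open>x + y\<close> on \<open>b2\<close> splits into a part
    matched with blue, bounded by \<open>b22\<close>, and the excess matched with red, bounded by
    \<open>b12\<close>.\<close>
  have "(x + y) * b2 = (z + t) / t * (y * b2) + ?d / (t * x) * (x * b2)"
    using \<open>x > 0\<close> \<open>t > 0\<close> by (simp add: divide_simps) algebra
  also have "\<dots> \<le> (z + t) / t * (t * a2) + ?d / (t * x) * (t * (a1 + x))"
    using \<open>x > 0\<close> \<open>t > 0\<close> nn le by (intro add_mono mult_left_mono b22 b12) auto
  finally have 2: "(x + y) * b2 \<le> \<dots>" .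
  have "(x + y) / x * (z * a1) + ((z + t) / t * (t * a2) + ?d / (t * x) * (t * (a1 + x)))
      = (z + t) * (a1 + a2) + ?d"
    using \<open>x > 0\<close> \<open>t > 0\<close> by (simp add: divide_simps) algebra
  then show ?thesis
    using 1 2 by (simp add: distrib_left)
qed

text \<open>For nonempty sets, division by \<open>card S * card T\<close> turns this into a
  comparison of the two means, with the difference of the red proportions as error.\<close>

lemma coupling_ineq:
  fixes a b :: "'a \<Rightarrow> real" and red :: "'a \<Rightarrow> bool"
  assumes fin: "finite S" "finite T"
    and le: "\<And>i j. i \<in> S \<Longrightarrow> j \<in> T \<Longrightarrow> b j \<le> a i + of_bool (red i \<noteq> red j)"
  shows "card S * sum b T \<le> card T * sum a S
    + \<bar>real (card {i\<in>S. red i}) * card T - real (card {i\<in>T. red i}) * card S\<bar>"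
proof -
  let ?S1 = "{i\<in>S. red i}" and ?S2 = "{i\<in>S. \<not> red i}"
  let ?T1 = "{i\<in>T. red i}" and ?T2 = "{i\<in>T. \<not> red i}"
  \<comment> \<open>Sum the hypothesis over all pairs from one class of each set; the cost
    \<open>e\<close> is \<open>0\<close> for equal colours and \<open>1\<close> otherwise.\<close>
  have pair: "card A * sum b B \<le> card B * (sum a A + e * card A)"
    if "A \<subseteq> S" "B \<subseteq> T" "\<And>i j. i \<in> A \<Longrightarrow> j \<in> B \<Longrightarrow> of_bool (red i \<noteq> red j) \<le> e" for A B and e :: real
  proof -
    have "(\<Sum>j\<in>B. \<Sum>i\<in>A. b j) \<le> (\<Sum>j\<in>B. \<Sum>i\<in>A. a i + e)"
    proof (intro sum_mono)
      fix i j assume ij: "j \<in> B" "i \<in> A"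
      then have "b j \<le> a i + of_bool (red i \<noteq> red j)" using that le by blast
      then show "b j \<le> a i + e" using that(3)[OF ij(2,1)] by linarith
    qed
    then show ?thesis
      by (simp add: sum_distrib_right sum.distrib mult.commute)
  qed
  have split: "sum f A = sum f {i\<in>A. red i} + sum f {i\<in>A. \<not> red i}" if "finite A" for f :: "'a \<Rightarrow> real" and A
  proof -
    have "sum f ({i\<in>A. red i} \<union> {i\<in>A. \<not> red i}) = sum f {i\<in>A. red i} + sum f {i\<in>A. \<not> red i}"
      using that by (intro sum.union_disjoint) auto
    moreover have "{i\<in>A. red i} \<union> {i\<in>A. \<not> red i} = A"
      by auto
    ultimately show ?thesis by simp
  qed
  have card: "real (card A) = card {i\<in>A. red i} + card {i\<in>A. \<not> red i}" if "finite A" for A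
    using split[OF that, of "\<lambda>_. 1"] by simp
  have zero: "sum f {i\<in>A. P i} = 0" if "finite A" "real (card {i\<in>A. P i}) = 0" for f :: "'a \<Rightarrow> real" and A P
  proof -
    have "{i\<in>A. P i} = {}"
      using that by (metis card_0_eq finite_Collect_conjI Collect_mem_eq of_nat_eq_0_iff)
    then show ?thesis by (simp only: sum.empty)
  qed
  let ?d = "real (card ?S1) * card ?T2 - real (card ?T1) * card ?S2"
  have d: "real (card ?S1) * card T - real (card ?T1) * card S = ?d"
    unfolding card[OF fin(1)] card[OF fin(2)] by (simp add: algebra_simps)
  show ?thesis
  \<comment> \<open>The sign of \<open>?d\<close> tells which colour is in excess in
    \<open>S\<close>; if it is blue, the colours exchange roles.\<close>
  proof (cases "?d \<ge> 0")
    case True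
    have "(real (card ?S1) + card ?S2) * (sum b ?T1 + sum b ?T2)
      \<le> (real (card ?T1) + card ?T2) * (sum a ?S1 + sum a ?S2) + ?d"
      using pair[of ?S1 ?T1 0] pair[of ?S2 ?T2 0] pair[of ?S1 ?T2 1] True
      by (intro coupling_ineq_wlog) (auto intro: zero simp: fin)
    then show ?thesis
      unfolding d unfolding split[OF fin(1)] split[OF fin(2)] card[OF fin(1)] card[OF fin(2)] using True by simp
  next
    case False
    have "(real (card ?S2) + card ?S1) * (sum b ?T2 + sum b ?T1)
      \<le> (real (card ?T2) + card ?T1) * (sum a ?S2 + sum a ?S1)
         + (real (card ?S2) * card ?T1 - real (card ?T2) * card ?S1)"
      using pair[of ?S1 ?T1 0] pair[of ?S2 ?T2 0] pair[of ?S2 ?T1 1] False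
      by (intro coupling_ineq_wlog) (auto intro: zero simp: fin mult.commute)
    moreover have "\<bar>?d\<bar> = real (card ?S2) * card ?T1 - real (card ?T2) * card ?S1"
      using False by (simp add: mult.commute)
    ultimately show ?thesis
      unfolding d split[OF fin(1)] split[OF fin(2)] unfolding card[OF fin(1)] card[OF fin(2)]
      by (simp only: of_nat_add add.commute)
  qed
qed

section \<open>Deviation of the number of red elements in a random \<open>k\<close>-subset\<close>

lemma finite_n_subsets: "finite A \<Longrightarrow> finite {S. S \<subseteq> A \<and> card S = k}"
  by (rule finite_subset[of _ "Pow A"]) auto

text \<open>Removing \<open>i\<close> leaves an arbitrary \<open>(k - 1)\<close>-subset of
  \<open>A - {i, j}\<close>.\<close>

lemma card_n_subsets_separating:
  assumes fin: "finite A" and ij: "i \<in> A" "j \<in> A" "i \<noteq> j" and k: "k > 0"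
  shows "card {S. S \<subseteq> A \<and> card S = k \<and> i \<in> S \<and> j \<notin> S} = (card A - 2) choose (k - 1)"
proof -
  let ?X = "{S. S \<subseteq> A \<and> card S = k \<and> i \<in> S \<and> j \<notin> S}"
  have "bij_betw (\<lambda>S. S - {i}) ?X {S. S \<subseteq> A - {i, j} \<and> card S = k - 1}"
  proof (rule bij_betw_byWitness[where f' = "insert i"])
    show "insert i ` {S. S \<subseteq> A - {i, j} \<and> card S = k - 1} \<subseteq> ?X"
    proof (clarify, intro conjI)
      fix S assume S: "S \<subseteq> A - {i, j}" "card S = k - 1"
      then have "finite S" "i \<notin> S" using fin finite_subset by blast+
      then show "card (insert i S) = k" using S k by simp
    qed (use ij in auto)
  qed auto
  then have "card ?X = card {S. S \<subseteq> A - {i, j} \<and> card S = k - 1}"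
    by (rule bij_betw_same_card)
  also have "\<dots> = card (A - {i, j}) choose (k - 1)"
    using fin by (intro n_subsets) auto
  finally show ?thesis
    using fin ij by (simp add: card_Diff_subset numeral_2_eq_2)
qed

lemma sum_square_n_subsets:
  fixes a :: "'a \<Rightarrow> real"
  assumes fin: "finite A" and a: "sum a A = 0" and k: "k > 0"
  shows "(\<Sum>S | S \<subseteq> A \<and> card S = k. (sum a S)\<^sup>2)
    = real ((card A - 2) choose (k - 1)) * (\<Sum>i\<in>A. (a i)\<^sup>2)"
proof -
  let ?F = "{S. S \<subseteq> A \<and> card S = k}" and ?C = "real ((card A - 2) choose (k - 1))"
  \<comment> \<open>As \<open>a\<close> sums to \<open>0\<close>, the square is minus the product of the sums over \<open>S\<close> and over its complement;
    this leaves a single count of subsets separating two points.\<close>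
  have "(sum a S)\<^sup>2 = - (\<Sum>i\<in>A. \<Sum>j\<in>A. a i * a j * of_bool (i \<in> S \<and> j \<notin> S))" if "S \<in> ?F" for S
  proof -
    have "sum a (A - S) = - sum a S"
      using that a sum_diff[OF fin, of S a] by simp
    moreover have "(\<Sum>i\<in>A. a i * of_bool (i \<in> S)) = sum a S"
        "(\<Sum>j\<in>A. a j * of_bool (j \<notin> S)) = sum a (A - S)"
      using that fin by (auto intro!: sum.mono_neutral_cong_right)
    moreover have "(\<Sum>i\<in>A. \<Sum>j\<in>A. a i * a j * of_bool (i \<in> S \<and> j \<notin> S))
        = (\<Sum>i\<in>A. a i * of_bool (i \<in> S)) * (\<Sum>j\<in>A. a j * of_bool (j \<notin> S))"
      unfolding sum_product by (intro sum.cong) auto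
    ultimately show ?thesis by (simp add: power2_eq_square)
  qed
  then have "(\<Sum>S\<in>?F. (sum a S)\<^sup>2)
      = (\<Sum>S\<in>?F. - (\<Sum>i\<in>A. \<Sum>j\<in>A. a i * a j * of_bool (i \<in> S \<and> j \<notin> S)))"
    by (rule sum.cong[OF refl])
  also have "\<dots> = - (\<Sum>S\<in>?F. \<Sum>i\<in>A. \<Sum>j\<in>A. a i * a j * of_bool (i \<in> S \<and> j \<notin> S))"
    by (rule sum_negf)
  also have "\<dots> = - (\<Sum>i\<in>A. \<Sum>j\<in>A. \<Sum>S\<in>?F. a i * a j * of_bool (i \<in> S \<and> j \<notin> S))"
    by (simp add: sum.swap[of _ _ ?F])
  also have "\<dots> = - (\<Sum>i\<in>A. \<Sum>j\<in>A. a i * a j * (?C * of_bool (i \<noteq> j)))"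
  proof -
    have "(\<Sum>S\<in>?F. a i * a j * of_bool (i \<in> S \<and> j \<notin> S)) = a i * a j * (?C * of_bool (i \<noteq> j))"
      if "i \<in> A" "j \<in> A" for i j
    proof -
      have "(\<Sum>S\<in>?F. of_bool (i \<in> S \<and> j \<notin> S) :: real) = card (?F \<inter> {S. i \<in> S \<and> j \<notin> S})"
        using finite_n_subsets[OF fin] by simp
      also have "?F \<inter> {S. i \<in> S \<and> j \<notin> S} = {S. S \<subseteq> A \<and> card S = k \<and> i \<in> S \<and> j \<notin> S}"
        by auto
      also have "real (card \<dots>) = ?C * of_bool (i \<noteq> j)"
        using card_n_subsets_separating[OF fin that _ k] by auto
      finally show ?thesis by (simp add: sum_distrib_left[symmetric])
    qed
    then show ?thesis by simp
  qed
  \<comment> \<open>Complete the sum over \<open>j \<noteq> i\<close> to all of \<open>A\<close>;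
    since \<open>sum a A = 0\<close>, only the diagonal terms will survive.\<close>
  also have "\<dots> = - (\<Sum>i\<in>A. ?C * (a i * sum a A - (a i)\<^sup>2))"
  proof -
    have "(\<Sum>j\<in>A. a i * a j * (?C * of_bool (i \<noteq> j))) = ?C * (a i * sum a A - (a i)\<^sup>2)" if "i \<in> A" for i
    proof -
      have "(\<Sum>j\<in>A. a i * a j * (?C * of_bool (i \<noteq> j))) = (\<Sum>j\<in>A - {i}. ?C * a i * a j)"
        using fin by (intro sum.mono_neutral_cong_right) auto
      also have "\<dots> = ?C * a i * (sum a A - a i)"
        using fin that by (simp add: sum_distrib_left[symmetric] sum_diff1)
      finally show ?thesis by (simp add: power2_eq_square algebra_simps)
    qed
    then show ?thesis by simp
  qed
  also have "\<dots> = ?C * (\<Sum>i\<in>A. (a i)\<^sup>2)"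
    by (simp add: a sum_negf sum_distrib_left)
  finally show ?thesis .
qed


text \<open>The mean absolute deviation is at most the standard deviation, which is largest when
  half of \<open>A\<close> satisfies \<open>P\<close>.\<close>

lemma sum_hypergeometric_deviation_le:
  assumes fin: "finite A" and k: "0 < k" "k < card A"
  shows "(\<Sum>S | S \<subseteq> A \<and> card S = k. \<bar>real (card A) * card {i\<in>S. P i} - real k * card {i\<in>A. P i}\<bar>)
    \<le> (card A choose k) * (real (card A) / 2 * sqrt (real k * (real (card A) - k) / (real (card A) - 1)))"
proof -
  define n where "n = card A"
  define r where "r = card {i\<in>A. P i}"
  \<comment> \<open>The indicator of \<open>P\<close> minus its mean \<open>r / n\<close>, scaled by
    \<open>n\<close>.\<close>
  define a where "a i = real n * of_bool (P i) - r" for i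
  \<comment> \<open>An upper bound for the standard deviation of \<open>sum a S\<close>, obtained
    from \<open>r * (n - r) \<le> n^2 / 4\<close>.\<close>
  define s where "s = real n / 2 * sqrt (real k * (real n - k) / (real n - 1))"
  let ?F = "{S. S \<subseteq> A \<and> card S = k}"
  have n: "k < n" "n \<ge> 2" "r \<le> n"
    using k card_mono[OF fin, of "{i\<in>A. P i}"] by (auto simp: n_def r_def)
  have s: "s > 0"
    using n k by (simp add: s_def)
  have sum_a: "sum a S = real n * card {i\<in>S. P i} - real (card S) * r" if "S \<subseteq> A" for S
    using finite_subset[OF that fin]
    by (simp add: a_def sum_subtractf sum_distrib_left[symmetric] Int_def conj_commute)
  have "sum a A = 0"
    by (simp add: sum_a r_def n_def)
  have "(\<Sum>i\<in>A. (a i)\<^sup>2) = (\<Sum>i\<in>A. real n * (real n - 2 * r) * of_bool (P i) + (real r)\<^sup>2)"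
    by (intro sum.cong) (auto simp: a_def power2_eq_square algebra_simps)
  also have "\<dots> = real n * (real n - 2 * r) * r + n * (real r)\<^sup>2"
    using fin by (simp add: sum.distrib sum_distrib_left[symmetric] n_def r_def Int_def conj_commute)
  also have "\<dots> = real n * (r * (real n - r))"
    by (simp add: power2_eq_square algebra_simps)
  also have "\<dots> \<le> real n * ((real n)\<^sup>2 / 4)"
  proof (intro mult_left_mono)
    show "r * (real n - r) \<le> (real n)\<^sup>2 / 4"
      using zero_le_power2[of "real n - 2 * r"] by (simp add: power2_eq_square algebra_simps)
  qed simp
  finally have sq: "(\<Sum>i\<in>A. (a i)\<^sup>2) \<le> real n ^ 3 / 4"
    by (simp add: power2_eq_square power3_eq_cube)
  \<comment> \<open>Two absorption identities express the separating count through
    \<open>n choose k\<close>, the number of subsets averaged over.\<close>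
  have "k * (n choose k) = n * ((n - 1) choose (k - 1))"
    using binomial_absorption[of "k - 1" n] k by simp
  moreover have "(n - k) * ((n - 1) choose (k - 1)) = (n - 1) * ((n - 2) choose (k - 1))"
    using binomial_absorb_comp[of "n - 1" "k - 1"] k n by (simp add: numeral_2_eq_2)
  ultimately have "k * (n - k) * (n choose k) = n * (n - 1) * ((n - 2) choose (k - 1))"
    by (metis mult.assoc mult.left_commute)
  then have "real k * real (n - k) * real (n choose k) = real n * real (n - 1) * real ((n - 2) choose (k - 1))"
    by (metis of_nat_mult)
  then have "real k * (real n - k) * (n choose k) = real n * (real n - 1) * real ((n - 2) choose (k - 1))"
    using n k by (simp add: of_nat_diff)
  moreover have "s\<^sup>2 = (real n)\<^sup>2 / 4 * (real k * (real n - k) / (real n - 1))"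
    using n by (simp add: s_def power_mult_distrib power_divide)
  moreover have "C2 * (real n ^ 3 / 4) = C * ((real n)\<^sup>2 / 4 * (K / (real n - 1)))"
    if "K * C = real n * (real n - 1) * C2" for C C2 K :: real
  proof -
    have "C * ((real n)\<^sup>2 / 4 * (K / (real n - 1))) = (real n)\<^sup>2 / 4 * (K * C / (real n - 1))"
      by simp
    also have "\<dots> = C2 * (real n ^ 3 / 4)"
      unfolding that using n by (simp add: power2_eq_square power3_eq_cube)
    finally show ?thesis ..
  qed
  ultimately have binom: "real ((n - 2) choose (k - 1)) * (real n ^ 3 / 4) = (n choose k) * s\<^sup>2"
    by metis
  \<comment> \<open>This pointwise bound takes the place of Cauchy-Schwarz; it is sharp when the
    absolute value equals \<open>s\<close>.\<close>
  have "(\<Sum>S\<in>?F. \<bar>sum a S\<bar>) \<le> (\<Sum>S\<in>?F. ((sum a S)\<^sup>2 / s + s) / 2)"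
  proof (rule sum_mono)
    fix S
    have "2 * (\<bar>sum a S\<bar> * s) \<le> (sum a S)\<^sup>2 + s\<^sup>2"
      using zero_le_power2[of "\<bar>sum a S\<bar> - s"] by (simp add: power2_diff)
    then show "\<bar>sum a S\<bar> \<le> ((sum a S)\<^sup>2 / s + s) / 2"
      using s by (simp add: field_simps power2_eq_square)
  qed
  also have "\<dots> = ((\<Sum>S\<in>?F. (sum a S)\<^sup>2) / s + card ?F * s) / 2"
    by (simp add: sum.distrib sum_divide_distrib[symmetric])
  also have "(\<Sum>S\<in>?F. (sum a S)\<^sup>2) \<le> (n choose k) * s\<^sup>2"
    unfolding sum_square_n_subsets[OF fin \<open>sum a A = 0\<close> k(1)] binom[symmetric]
    unfolding n_def[symmetric] using sq by (intro mult_left_mono) auto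
  also have "((n choose k) * s\<^sup>2 / s + card ?F * s) / 2 = (n choose k) * s"
    using s n_subsets[OF fin] by (simp add: n_def power2_eq_square)
  finally have "(\<Sum>S\<in>?F. \<bar>sum a S\<bar>) \<le> (n choose k) * s"
    using s by (simp add: divide_right_mono)
  also have "(\<Sum>S\<in>?F. \<bar>sum a S\<bar>) = (\<Sum>S\<in>?F. \<bar>real n * card {i\<in>S. P i} - real k * r\<bar>)"
    by (intro sum.cong) (auto simp: sum_a)
  finally show ?thesis
    unfolding s_def n_def r_def .
qed

section \<open>Recursion for the averages over the size \<open>k\<close> of the direction
  set\<close>

text \<open>A \<open>Suc k\<close>-subset with a marked element \<open>j\<close> is the same as a
  \<open>k\<close>-subset with a point \<open>j\<close> outside it.\<close>

lemma sum_n_subsets_Suc: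
  fixes f :: "'a set \<Rightarrow> 'a \<Rightarrow> real"
  assumes "finite A"
  shows "(\<Sum>S | S \<subseteq> A \<and> card S = Suc k. \<Sum>j\<in>S. f S j)
    = (\<Sum>S | S \<subseteq> A \<and> card S = k. \<Sum>j\<in>A - S. f (insert j S) j)"
proof -
  have fin: "finite S" if "S \<subseteq> A" for S
    using that assms finite_subset by blast
  have "(\<Sum>(S, j)\<in>(SIGMA S:{S. S \<subseteq> A \<and> card S = Suc k}. S). f S j)
      = (\<Sum>(S, j)\<in>(SIGMA S:{S. S \<subseteq> A \<and> card S = k}. A - S). f (insert j S) j)"
    by (rule sum.reindex_bij_witness[where i = "\<lambda>(S, j). (insert j S, j)" and j = "\<lambda>(S, j). (S - {j}, j)"])
      (auto simp: insert_absorb fin)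
  then show ?thesis
    using finite_n_subsets[OF assms] fin assms by (simp add: sum.Sigma)
qed

text \<open>The average over all triples \<open>(w, S, i)\<close> is this total divided by
  \<open>2 ^ n * (n choose k) * k\<close>.\<close>

definition level_sum :: "(bool list set \<Rightarrow> 'c) \<Rightarrow> nat \<Rightarrow> nat \<Rightarrow> real" where
  "level_sum c n k =
     (\<Sum>w\<in>cube_verts n. \<Sum>S | S \<subseteq> {..<n} \<and> card S = k. \<Sum>i\<in>S. real (min_changes c w S i))"

lemma level_sum_1: "level_sum c n 1 = 0"
  unfolding level_sum_def by (intro sum.neutral ballI) (auto simp: card_1_singleton_iff min_changes_singleton)

lemma level_sum_Suc:
  fixes c :: "bool list set \<Rightarrow> bool"
  assumes k: "0 < k" "k < n"
  shows "k * level_sum c n (Suc k) \<le> (real n - k) * level_sum c n k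
    + 2 ^ n * ((n choose k) * (real n / 2 * sqrt (real k * (real n - k) / (real n - 1))))"
proof -
  let ?V = "cube_verts n" and ?F = "{S. S \<subseteq> {..<n} \<and> card S = k}"
  let ?dev = "\<lambda>w S. \<bar>real n * card {i\<in>S. c {w, flip w i}} - real k * card {i\<in>{..<n}. c {w, flip w i}}\<bar>"
  have "level_sum c n (Suc k)
      = (\<Sum>w\<in>?V. \<Sum>S\<in>?F. \<Sum>j\<in>{..<n} - S. real (min_changes c w (insert j S) j))"
    by (simp add: level_sum_def sum_n_subsets_Suc)
  also have "\<dots> = (\<Sum>S\<in>?F. \<Sum>j\<in>{..<n} - S. \<Sum>w\<in>?V. real (min_changes c w (insert j S) j))"
    by (simp add: sum.swap[of _ _ ?V])
  \<comment> \<open>For fixed \<open>S\<close> and \<open>j\<close>, rebase the longer path at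
    \<open>flip w j\<close>: after its first edge it continues from \<open>w\<close> with the
    directions in \<open>S\<close>.\<close>
  also have "\<dots> = (\<Sum>S\<in>?F. \<Sum>j\<in>{..<n} - S. \<Sum>w\<in>?V. real (min_changes c (flip w j) (insert j S) j))"
    by (subst sum_cube_verts_flip) simp
  also have "\<dots> = (\<Sum>w\<in>?V. \<Sum>S\<in>?F. \<Sum>j\<in>{..<n} - S. real (min_changes c (flip w j) (insert j S) j))"
    by (simp add: sum.swap[of _ _ ?V])
  finally have "k * level_sum c n (Suc k)
      = (\<Sum>w\<in>?V. \<Sum>S\<in>?F. k * (\<Sum>j\<in>{..<n} - S. real (min_changes c (flip w j) (insert j S) j)))"
    by (simp add: sum_distrib_left)
  also have "\<dots> \<le> (\<Sum>w\<in>?V. \<Sum>S\<in>?F. (real n - k) * (\<Sum>i\<in>S. real (min_changes c w S i)) + ?dev w S)"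
  proof (intro sum_mono)
    fix w S assume "S \<in> ?F"
    then have S: "S \<subseteq> {..<n}" "card S = k" "finite S"
      using finite_subset by auto
    let ?T = "{..<n} - S"
    let ?red = "\<lambda>i. c {w, flip w i}"
    have T: "card ?T = n - k"
      using S by (simp add: card_Diff_subset)
    \<comment> \<open>Comparing red inside \<open>S\<close> with red outside amounts to comparing it
      with red among all directions, which is the hypergeometric deviation.\<close>
    have "{i\<in>{..<n}. ?red i} = {i\<in>S. ?red i} \<union> {i\<in>?T. ?red i}"
      using S by auto
    also have "card \<dots> = card {i\<in>S. ?red i} + card {i\<in>?T. ?red i}"
      using S by (intro card_Un_disjoint) auto
    finally have "real (card {i\<in>S. ?red i}) * card ?T - real (card {i\<in>?T. ?red i}) * card S
        = real n * card {i\<in>S. ?red i} - real k * card {i\<in>{..<n}. ?red i}"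
      using k S T by (simp add: of_nat_diff algebra_simps)
    moreover have "card S * (\<Sum>j\<in>?T. real (min_changes c (flip w j) (insert j S) j))
        \<le> card ?T * (\<Sum>i\<in>S. real (min_changes c w S i))
          + \<bar>real (card {i\<in>S. ?red i}) * card ?T - real (card {i\<in>?T. ?red i}) * card S\<bar>"
    proof (rule coupling_ineq)
      fix i j assume "i \<in> S" "j \<in> ?T"
      then have "min_changes c (flip w j) (insert j S) j \<le> min_changes c w S i + of_bool (?red i \<noteq> ?red j)"
        using S by (intro min_changes_insert_le) auto
      then have "real (min_changes c (flip w j) (insert j S) j)
          \<le> real (min_changes c w S i + of_bool (?red i \<noteq> ?red j))"
        by (simp only: of_nat_le_iff)
      then show "real (min_changes c (flip w j) (insert j S) j)
          \<le> real (min_changes c w S i) + of_bool (?red i \<noteq> ?red j)"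
        by simp
    qed (use S in auto)
    ultimately show "k * (\<Sum>j\<in>?T. real (min_changes c (flip w j) (insert j S) j))
        \<le> (real n - k) * (\<Sum>i\<in>S. real (min_changes c w S i)) + ?dev w S"
      using k by (simp add: S T of_nat_diff)
  qed
  also have "\<dots> = (real n - k) * level_sum c n k + (\<Sum>w\<in>?V. \<Sum>S\<in>?F. ?dev w S)"
    by (simp add: level_sum_def sum.distrib sum_distrib_left)
  also have "(\<Sum>w\<in>?V. \<Sum>S\<in>?F. ?dev w S)
      \<le> (\<Sum>w\<in>?V. (n choose k) * (real n / 2 * sqrt (real k * (real n - k) / (real n - 1))))"
  proof (rule sum_mono)
    fix w
    show "(\<Sum>S\<in>?F. ?dev w S) \<le> (n choose k) * (real n / 2 * sqrt (real k * (real n - k) / (real n - 1)))"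
      using sum_hypergeometric_deviation_le[of "{..<n}" k "\<lambda>i. c {w, flip w i}"] k by simp
  qed
  finally show ?thesis
    by (simp add: card_cube_verts)
qed

text \<open>Divide the recursion by \<open>2 ^ n * (n choose k) * k * (n - k)\<close>; the identity
  \<open>(n - k) * (n choose k) = Suc k * (n choose Suc k)\<close> matches the normalisations of the
  two levels.\<close>

lemma level_average_Suc:
  fixes c :: "bool list set \<Rightarrow> bool"
  assumes k: "0 < k" "k < n"
  shows "level_sum c n (Suc k) / (2 ^ n * (n choose Suc k) * Suc k)
    \<le> level_sum c n k / (2 ^ n * (n choose k) * k) + n / (2 * sqrt (real n - 1)) * (1 / sqrt (real k * (real n - k)))"
proof -
  let ?N = "2 ^ n * real (n choose k)" and ?m = "real n - real k"
  have pos: "?N > 0" "real k > 0" "?m > 0"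
    using k by auto
  have "(n - k) * (n choose k) = Suc k * (n choose Suc k)"
    using binomial_absorb_comp[of n k] binomial_absorption[of k n] by simp
  then have "real (n - k) * real (n choose k) = real (Suc k) * real (n choose Suc k)"
    by (metis of_nat_mult)
  then have "?m * (n choose k) = real (n choose Suc k) * Suc k"
    using k by (simp add: of_nat_diff mult.commute)
  then have "level_sum c n (Suc k) / (2 ^ n * (n choose Suc k) * Suc k)
      = k * level_sum c n (Suc k) / (?N * k * ?m)"
  proof -
    have "2 ^ n * real (n choose Suc k) * real (Suc k) = ?N * ?m"
      using \<open>?m * (n choose k) = real (n choose Suc k) * Suc k\<close>
      by (metis mult.assoc mult.commute)
    then show ?thesis
      unfolding of_nat_mult using pos by (simp del: of_nat_Suc)
  qed
  also have "\<dots> \<le> (?m * level_sum c n k + ?N * (real n / 2 * sqrt (real k * ?m / (real n - 1)))) / (?N * k * ?m)"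
    using level_sum_Suc[OF k, of c] pos by (intro divide_right_mono) (auto simp: mult_ac)
  also have "\<dots> = level_sum c n k / (?N * k) + real n / 2 * (sqrt (real k * ?m / (real n - 1)) / (k * ?m))"
    using pos by (simp add: add_divide_distrib mult_ac)
  also have "sqrt (real k * ?m / (real n - 1)) / (k * ?m) = 1 / sqrt (real n - 1) * (1 / sqrt (real k * ?m))"
    using pos real_div_sqrt[of "real k * ?m"] by (simp add: real_sqrt_divide field_simps)
  finally show ?thesis
    by (simp add: mult_ac)
qed

lemma level_average_le:
  fixes c :: "bool list set \<Rightarrow> bool"
  assumes "Suc k \<le> n"
  shows "level_sum c n (Suc k) / (2 ^ n * (n choose Suc k) * Suc k)
    \<le> n / (2 * sqrt (real n - 1)) * (\<Sum>i=1..k. 1 / sqrt (real i * (real n - i)))"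
  using assms
proof (induction k)
  case 0
  then show ?case using level_sum_1[of c n] by simp
next
  case (Suc k)
  then show ?case
    using level_average_Suc[of "Suc k" n c] by (simp add: distrib_left)
qed

section \<open>Comparison of the error sum with \<open>pi\<close>\<close>

lemma has_real_derivative_arcsin_affine:
  assumes "0 < x" "x < n"
  shows "((\<lambda>x. arcsin (2 * x / n - 1)) has_real_derivative 1 / sqrt (x * (n - x))) (at x)"
proof -
  have n: "n > 0" and b: "-1 < 2 * x / n - 1" "2 * x / n - 1 < 1"
    using assms by (auto simp: field_simps)
  have "1 - (2 * x / n - 1)\<^sup>2 = 4 * (x * (n - x)) / n\<^sup>2"
    using n by (simp add: power2_eq_square field_simps)
  then have "sqrt (1 - (2 * x / n - 1)\<^sup>2) = 2 * sqrt (x * (n - x)) / n"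
    using n by (simp add: real_sqrt_divide real_sqrt_mult)
  moreover have "((\<lambda>x. arcsin (2 * x / n - 1)) has_real_derivative
      inverse (sqrt (1 - (2 * x / n - 1)\<^sup>2)) * (2 / n)) (at x)"
    using b n by (intro DERIV_chain2[of arcsin, OF DERIV_arcsin]) (auto intro!: derivative_eq_intros)
  ultimately show ?thesis
    using n by simp
qed

text \<open>The mean value theorem replaces integration. It needs only continuity at the end points,
  so \<open>u = 0\<close> and \<open>v = n\<close>, where the derivative is unbounded, are
  allowed.\<close>

lemma arcsin_increment:
  assumes "0 \<le> u" "u < v" "v \<le> n"
  obtains x where "u < x" "x < v"
    "arcsin (2 * v / n - 1) - arcsin (2 * u / n - 1) = (v - u) / sqrt (x * (n - x))"
proof -
  let ?F = "\<lambda>x. arcsin (2 * x / n - 1)"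
  have cont: "continuous_on {u..v} ?F"
    using assms by (intro continuous_intros) (auto simp: field_simps)
  have deriv: "(?F has_derivative (*) (1 / sqrt (x * (n - x)))) (at x)" if "u < x" "x < v" for x
    using has_real_derivative_arcsin_affine[of x n] that assms by (simp add: has_field_derivative_def)
  show thesis
  proof (rule mvt[OF \<open>u < v\<close> cont deriv])
    fix x assume "u < x" "x < v" "?F v - ?F u = 1 / sqrt (x * (n - x)) * (v - u)"
    then show thesis
      using that by simp
  qed
qed

text \<open>The summand decreases up to \<open>n / 2\<close> and increases afterwards, so each term is bounded by the
  integral over the adjacent unit interval on the outer side; the interval \<open>[h, h + 1]\<close> in the middle
  is not used.\<close>

lemma sum_inverse_sqrt_le_pi:
  "(\<Sum>i=1..n-1. 1 / sqrt (real i * (real n - i))) \<le> pi"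
proof (cases "n = 0")
  case False
  let ?F = "\<lambda>k::nat. arcsin (2 * real k / n - 1)"
  let ?g = "\<lambda>i. 1 / sqrt (real i * (real n - i))"
  have g_le: "?g i \<le> 1 / sqrt (x * (n - x))"
    if "0 < x" "x < n" "x * (n - x) \<le> real i * (real n - i)" "0 < i" "i < n" for x :: real and i
    using that by (intro divide_left_mono real_sqrt_le_mono) (auto simp: of_nat_diff zero_less_mult_iff)
  have left: "?g (Suc i) \<le> ?F (Suc i) - ?F i" if "2 * Suc i \<le> n" for i
  proof -
    have "0 \<le> real i" "real i < real (Suc i)" "real (Suc i) \<le> real n"
      using that by auto
    then obtain x :: real where x: "i < x" "x < Suc i"
        "?F (Suc i) - ?F i = (real (Suc i) - i) / sqrt (x * (n - x))"
      by (rule arcsin_increment)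
    \<comment> \<open>The product equals \<open>Suc i * (n - Suc i) - x * (n - x)\<close>; the
      analogous product below serves the right half.\<close>
    have "0 \<le> (Suc i - x) * (n - Suc i - x)"
      using x that by (intro mult_nonneg_nonneg) auto
    then show ?thesis
      using g_le[of x "Suc i"] x that by (simp add: algebra_simps)
  qed
  have right: "?g i \<le> ?F (Suc i) - ?F i" if "n \<le> 2 * i" "i < n" for i
  proof -
    have "0 \<le> real i" "real i < real (Suc i)" "real (Suc i) \<le> real n"
      using that by auto
    then obtain x :: real where x: "i < x" "x < Suc i"
        "?F (Suc i) - ?F i = (real (Suc i) - i) / sqrt (x * (n - x))"
      by (rule arcsin_increment)
    have "0 \<le> (x - i) * (x + i - n)"
      using x that by (intro mult_nonneg_nonneg) auto
    then show ?thesis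
      using g_le[of x i] x that by (simp add: algebra_simps)
  qed
  define h where "h = n div 2"
  have h: "2 * h \<le> n" "n \<le> 2 * Suc h" "h < n" "n < 2 * Suc h"
    using False by (auto simp: h_def)
  have "(\<Sum>i=1..n-1. ?g i) = (\<Sum>i\<in>{1..h}. ?g i) + (\<Sum>i\<in>{Suc h..<n}. ?g i)"
  proof -
    have "{1..n-1} = {1..h} \<union> {Suc h..<n}" "{1..h} \<inter> {Suc h..<n} = {}"
      using h by auto
    then show ?thesis
      by (simp only: sum.union_disjoint finite_atLeastAtMost finite_atLeastLessThan)
  qed
  also have "(\<Sum>i\<in>{1..h}. ?g i) = (\<Sum>i<h. ?g (Suc i))"
    by (rule sum.reindex_bij_witness[where i = Suc and j = "\<lambda>i. i - 1"]) auto
  also have "\<dots> \<le> (\<Sum>i<h. ?F (Suc i) - ?F i)"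
    using h by (intro sum_mono left) auto
  also have "\<dots> = ?F h - ?F 0"
    by (rule sum_lessThan_telescope)
  also have "(\<Sum>i\<in>{Suc h..<n}. ?g i) \<le> (\<Sum>i\<in>{Suc h..<n}. ?F (Suc i) - ?F i)"
    using h by (intro sum_mono right) auto
  also have "\<dots> = ?F n - ?F (Suc h)"
    using h by (intro sum_Suc_diff') auto
  also have "?F h \<le> ?F (Suc h)"
    using h by (intro arcsin_le_arcsin) (auto simp: field_simps)
  finally show ?thesis
    using False by simp
qed simp

section \<open>From the average to a single geodesic\<close>

theorem theorem1p3:
  "\<exists>\<epsilon> :: nat \<Rightarrow> real. \<epsilon> \<longlonglongrightarrow> 0 \<and>
     (\<forall>n \<ge> 1. \<forall>c :: bool list set \<Rightarrow> bool.
        \<exists>v \<in> cube_verts n. \<exists>p. cube_geodesic n v (antipode v) p \<and>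
          real (colour_changes c p) \<le> (pi / 2 + \<epsilon> n) * sqrt (real n))"
proof -
  define \<epsilon> :: "nat \<Rightarrow> real" where "\<epsilon> n = pi / 2 * (sqrt (inverse (1 - inverse n)) - 1)" for n
  \<comment> \<open>For \<open>n \<ge> 1\<close> the inverse equals \<open>n / (n - 1)\<close>; both are \<open>0\<close> for \<open>n = 1\<close>, where no colour change occurs.\<close>
  have "\<epsilon> \<longlonglongrightarrow> 0"
    unfolding \<epsilon>_def by (rule tendsto_eq_intros lim_inverse_n refl | simp)+
  moreover have "\<exists>v \<in> cube_verts n. \<exists>p. cube_geodesic n v (antipode v) p \<and>
      real (colour_changes c p) \<le> (pi / 2 + \<epsilon> n) * sqrt (real n)"
    if n: "n \<ge> 1" for n and c :: "bool list set \<Rightarrow> bool"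
  proof -
    let ?B = "(pi / 2 + \<epsilon> n) * sqrt (real n)"
    \<comment> \<open>At level \<open>n\<close> the only direction set is the full one, so
      \<open>level_sum\<close> runs over all starts and all first directions.\<close>
    have sub: "{S. S \<subseteq> {..<n} \<and> card S = n} = {{..<n}}"
      using card_subset_eq[of "{..<n}"] by auto
    have "level_sum c n n / (2 ^ n * n) \<le> n / (2 * sqrt (real n - 1)) * (\<Sum>i=1..n-1. 1 / sqrt (real i * (real n - i)))"
      using level_average_le[of "n - 1" n c] n by simp
    also have "\<dots> \<le> n / (2 * sqrt (real n - 1)) * pi"
      using n by (intro mult_left_mono sum_inverse_sqrt_le_pi) simp
    \<comment> \<open>The choice of \<open>\<epsilon>\<close> absorbs the factor
      \<open>sqrt (n / (n - 1))\<close> exactly.\<close>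
    also have "\<dots> = ?B"
    proof -
      have "inverse (1 - inverse (real n)) = real n / (real n - 1)"
        using n by (cases "n = 1") (auto simp: field_simps)
      then have "?B = pi / 2 * (sqrt (real n) / sqrt (real n - 1)) * sqrt (real n)"
        by (simp add: \<epsilon>_def real_sqrt_divide right_diff_distrib)
      then show ?thesis by simp
    qed
    finally have avg: "(\<Sum>w\<in>cube_verts n. \<Sum>i<n. real (min_changes c w {..<n} i))
        \<le> (\<Sum>w\<in>cube_verts n. \<Sum>i<n. ?B)"
      using n by (simp add: level_sum_def sub card_cube_verts field_simps)
    \<comment> \<open>Some pair does not exceed the average; \<open>n \<ge> 1\<close> ensures that
      there are pairs.\<close>
    have "\<exists>w\<in>cube_verts n. \<exists>i<n. real (min_changes c w {..<n} i) \<le> ?B"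
    proof (rule ccontr)
      assume "\<not> ?thesis"
      then have "(\<Sum>w\<in>cube_verts n. \<Sum>i<n. ?B) < (\<Sum>w\<in>cube_verts n. \<Sum>i<n. real (min_changes c w {..<n} i))"
        using n finite_cube_verts card_cube_verts[of n]
        by (intro sum_strict_mono) (auto simp: not_le lessThan_empty_iff)
      then show False using avg by simp
    qed
    then obtain w i where w: "w \<in> cube_verts n" "i < n" "real (min_changes c w {..<n} i) \<le> ?B"
      by blast
    obtain ds where ds: "distinct ds" "set ds = {..<n} - {i}"
        and eq: "min_changes c w {..<n} i = colour_changes c (flip_path w (i # ds))"
      using min_changes_attained[of "{..<n}" i c w] by auto
    have "cube_geodesic n w (antipode w) (flip_path w (i # ds))"
      using w ds by (intro cube_geodesic_flip_path) auto
    then show ?thesis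
      using w eq by metis
  qed
  ultimately show ?thesis by blast
qed

end
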